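(* Let $Q_{n,j}$ ($n,j\ge0$) be the formal power series in $\mathbf x=(x_1,x_2,\dots)$ given by $Q_{n,j}=\sum_{\sigma\in\mathfrak S_n,\ \mathrm{exc}(\sigma)=j}F_{\mathrm{EXD}(\sigma),n}(\mathbf x)$, and let $H(z)=\sum_{n\ge0}h_n(\mathbf x)z^n$. Then $$\sum_{n,j\ge0}Q_{n,j}\,t^jz^n=\frac{(1-t)H(z)}{H(zt)-tH(z)}.$$
   Context: $\mathbf x=(x_1,x_2,\dots)$ is an infinite sequence of commuting indeterminates; $h_n(\mathbf x)=\sum_{1\le i_1\le\dots\le i_n}x_{i_1}\cdots x_{i_n}$ is the complete homogeneous symmetric function, $h_0=1$. $\mathfrak S_n$ is the set of permutations of $[n]=\{1,\dots,n\}$, and $\mathrm{exc}(\sigma)=|\{i\in[n-1]:\sigma(i)>i\}|$. Excedance-descent set: for $\sigma\in\mathfrak S_n$ let $\bar\sigma$ be the word obtained from $\sigma(1)\sigma(2)\cdots\sigma(n)$ by placing a bar over each letter $\sigma(i)$ with $\sigma(i)>i$ (e.g. $531462\mapsto\bar5\bar314\bar62$), viewed as a word over the ordered alphabet $\bar1<\bar2<\dots<\bar n<1<2<\dots<n$. Then $\mathrm{EXD}(\sigma)=\{i\in[n-1]:\bar\sigma_i>\bar\sigma_{i+1}\}$, where $\bar\sigma_i$ is the $i$th letter of $\bar\sigma$. For $n\ge1$ and $S\subseteq[n-1]$, $F_{S,n}(\mathbf x)=\sum x_{i_1}\cdots x_{i_n}$, summed over all sequences of positive integers $i_1\ge i_2\ge\dots\ge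 i_n$ such that $i_j>i_{j+1}$ whenever $j\in S$; and $F_{\emptyset,0}=1$ (so $Q_{0,0}=1$ and $Q_{0,j}=0$ for $j>0$). The identity is one of formal power series in $z$, where the denominator on the right has constant term $1-t$ (invertible in $\mathbb Q(t)$ or $\mathbb Z[[t]]$). *)

theory Defs
  imports
    "HOL-Library.Multiset"
    "HOL-Combinatorics.Permutations"
    "HOL-Computational_Algebra.Formal_Power_Series"
begin

text \<open>
  Formal power series in commuting indeterminates indexed by \<open>'v\<close> (possibly infinitely many),
  with coefficients in \<open>'a\<close>.  The monomial \<open>x\<^sub>v\<^sub>1 \<cdots> x\<^sub>v\<^sub>n\<close> is the multiset \<open>mset [v1, \<dots>, vn]\<close>, and a
  power series is an arbitrary function from monomials to coefficients.
\<close>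

typedef ('v, 'a) mvps = "UNIV :: ('v multiset \<Rightarrow> 'a) set"
  morphisms mcoeff Abs_mvps
  by simp

lemma mcoeff_Abs [simp]: "mcoeff (Abs_mvps f) = f"
  by (simp add: Abs_mvps_inverse)

lemma mvps_eqI: "(\<And>m. mcoeff f m = mcoeff g m) \<Longrightarrow> f = g"
  by (metis ext mcoeff_inject)

definition msplits :: "'v multiset \<Rightarrow> ('v multiset \<times> 'v multiset) set" where
  "msplits m = {(a, b). a + b = m}"

lemma finite_submultisets: "finite {a. a \<subseteq># (m :: 'v multiset)}"
proof -
  have "{a. a \<subseteq># m} \<subseteq> mset ` {xs. set xs \<subseteq> set_mset m \<and> length xs \<le> size m}"
  proof
    fix a assume "a \<in> {a. a \<subseteq># m}"
    hence a: "a \<subseteq># m" by simp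
    obtain xs where xs: "mset xs = a" using ex_mset by blast
    have "set xs \<subseteq> set_mset m" using set_mset_mono[OF a] xs by auto
    moreover have "length xs \<le> size m" using size_mset_mono[OF a] xs by auto
    ultimately show "a \<in> mset ` {xs. set xs \<subseteq> set_mset m \<and> length xs \<le> size m}"
      using xs by blast
  qed
  thus ?thesis by (rule finite_subset) (simp add: finite_lists_length_le)
qed

lemma finite_msplits [simp]: "finite (msplits m)"
proof -
  have "msplits m \<subseteq> {a. a \<subseteq># m} \<times> {a. a \<subseteq># m}"
    by (auto simp: msplits_def)
  thus ?thesis by (rule finite_subset) (simp add: finite_submultisets)
qed

instantiation mvps :: (type, comm_ring_1) comm_ring_1
begin

definition "0 = Abs_mvps (\<lambda>_. 0)"
definition "1 = Abs_mvps (\<lambda>m. if m = {#} then 1 else 0)"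
definition "f + g = Abs_mvps (\<lambda>m. mcoeff f m + mcoeff g m)"
definition "f - g = Abs_mvps (\<lambda>m. mcoeff f m - mcoeff g m)"
definition "- f = Abs_mvps (\<lambda>m. - mcoeff f m)"
definition "f * g = Abs_mvps (\<lambda>m. \<Sum>(a, b)\<in>msplits m. mcoeff f a * mcoeff g b)"

lemmas mvps_defs = zero_mvps_def one_mvps_def plus_mvps_def minus_mvps_def uminus_mvps_def
  times_mvps_def

instance
proof
  fix f g h :: "('a, 'b) mvps"
  show "f + g + h = f + (g + h)" "f + g = g + f" "0 + f = f" "- f + f = 0" "f - g = f + - g"
    by (auto intro!: mvps_eqI simp: mvps_defs)
  show "(0 :: ('a, 'b) mvps) \<noteq> 1"
  proof
    assume "(0 :: ('a, 'b) mvps) = 1"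
    hence "mcoeff (0 :: ('a, 'b) mvps) {#} = mcoeff 1 {#}" by simp
    thus False by (simp add: mvps_defs)
  qed
  show "f * g = g * f"
  proof (rule mvps_eqI)
    fix m
    show "mcoeff (f * g) m = mcoeff (g * f) m"
      unfolding times_mvps_def mcoeff_Abs
      by (rule sum.reindex_bij_witness[of _ prod.swap prod.swap])
         (auto simp: msplits_def ac_simps)
  qed
  show "(f + g) * h = f * h + g * h"
    by (rule mvps_eqI)
       (simp add: times_mvps_def plus_mvps_def case_prod_unfold distrib_right sum.distrib)
  show "1 * f = f"
  proof (rule mvps_eqI)
    fix m
    have "mcoeff (1 * f) m = (\<Sum>p\<in>msplits m. if p = ({#}, m) then mcoeff f m else 0)"
      unfolding times_mvps_def mcoeff_Abs one_mvps_def
      by (rule sum.cong) (auto simp: msplits_def split: if_splits)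
    also have "\<dots> = mcoeff f m"
      by (subst sum.delta, rule finite_msplits) (auto simp: msplits_def)
    finally show "mcoeff (1 * f) m = mcoeff f m" .
  qed
  show "f * g * h = f * (g * h)"
  proof (rule mvps_eqI)
    fix m
    have "mcoeff (f * g * h) m =
        (\<Sum>p\<in>msplits m. \<Sum>q\<in>msplits (fst p). mcoeff f (fst q) * mcoeff g (snd q) * mcoeff h (snd p))"
      by (simp add: times_mvps_def case_prod_unfold sum_distrib_right)
    also have "\<dots> = (\<Sum>(p, q)\<in>Sigma (msplits m) (\<lambda>p. msplits (fst p)).
        mcoeff f (fst q) * mcoeff g (snd q) * mcoeff h (snd p))"
      by (rule sum.Sigma) auto
    also have "\<dots> = (\<Sum>(p, q)\<in>Sigma (msplits m) (\<lambda>p. msplits (snd p)).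
        mcoeff f (fst p) * (mcoeff g (fst q) * mcoeff h (snd q)))"
      by (rule sum.reindex_bij_witness
            [of _ "\<lambda>(p, q). ((fst p + fst q, snd q), (fst p, fst q))"
                  "\<lambda>(p, q). ((fst q, snd q + snd p), (snd q, snd p))"])
         (auto simp: msplits_def ac_simps)
    also have "\<dots> = (\<Sum>p\<in>msplits m. \<Sum>q\<in>msplits (snd p).
        mcoeff f (fst p) * (mcoeff g (fst q) * mcoeff h (snd q)))"
      by (rule sum.Sigma[symmetric]) auto
    also have "\<dots> = mcoeff (f * (g * h)) m"
      by (simp add: times_mvps_def case_prod_unfold sum_distrib_left)
    finally show "mcoeff (f * g * h) m = mcoeff (f * (g * h)) m" .
  qed
qed

end

text \<open>
  The formal sum of \<open>x\<^sub>w\<^sub>1 \<cdots> x\<^sub>w\<^sub>n\<close> over all words \<open>w\<close> in \<open>A\<close>.  Only finitely many words share a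
  given monomial, so the cardinality is that of a finite set even when \<open>A\<close> is infinite.
\<close>

definition word_series :: "'v list set \<Rightarrow> ('v, 'a :: comm_ring_1) mvps" where
  "word_series A = Abs_mvps (\<lambda>m. of_nat (card {w \<in> A. mset w = m}))"

lemma finite_words_of_monomial: "finite {w \<in> A. mset w = m}"
  by (rule finite_subset[OF _ mset_eq_finite[of "SOME w. mset w = m"]])
     (use someI_ex[OF ex_mset[of m]] in auto)

text \<open>
  Variables are indexed by the positive integers; the indeterminate with index 0 is available in
  the type but occurs in none of the series below.  Words \<open>i\<^sub>1 \<dots> i\<^sub>n\<close> are 0-based lists, so \<open>i\<^sub>j\<close> is
  \<open>w ! (j - 1)\<close>.
\<close>

type_synonym xps = "(nat, int) mvps"

definition hsym :: "nat \<Rightarrow> xps" where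
  "hsym n = word_series {w. length w = n \<and> (\<forall>i\<in>set w. 1 \<le> i) \<and> sorted w}"

definition Fquasi :: "nat set \<Rightarrow> nat \<Rightarrow> xps" where
  "Fquasi S n = word_series {w. length w = n \<and> (\<forall>i\<in>set w. 1 \<le> i) \<and>
     (\<forall>j\<in>{1..<n}. w ! (j - 1) \<ge> w ! j) \<and>
     (\<forall>j\<in>S. w ! (j - 1) > w ! j)}"

definition exc :: "nat \<Rightarrow> (nat \<Rightarrow> nat) \<Rightarrow> nat" where
  "exc n \<sigma> = card {i \<in> {1..<n}. \<sigma> i > i}"

datatype letter = Barred nat | Plain nat

fun letter_less :: "letter \<Rightarrow> letter \<Rightarrow> bool" where
  "letter_less (Barred a) (Barred b) \<longleftrightarrow> a < b"
| "letter_less (Barred a) (Plain b) \<longleftrightarrow> True"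
| "letter_less (Plain a) (Barred b) \<longleftrightarrow> False"
| "letter_less (Plain a) (Plain b) \<longleftrightarrow> a < b"

definition bar_word :: "(nat \<Rightarrow> nat) \<Rightarrow> nat \<Rightarrow> letter" where
  "bar_word \<sigma> i = (if \<sigma> i > i then Barred (\<sigma> i) else Plain (\<sigma> i))"

definition EXD :: "nat \<Rightarrow> (nat \<Rightarrow> nat) \<Rightarrow> nat set" where
  "EXD n \<sigma> = {i \<in> {1..<n}. letter_less (bar_word \<sigma> (i + 1)) (bar_word \<sigma> i)}"

definition Qeuler :: "nat \<Rightarrow> nat \<Rightarrow> xps" where
  "Qeuler n j = (\<Sum>\<sigma> | \<sigma> permutes {1..n} \<and> exc n \<sigma> = j. Fquasi (EXD n \<sigma>) n)"

text \<open>
  The ring of the identity is \<open>\<int>[[x]][[t]][[z]]\<close>, i.e. \<open>xps fps fps\<close>: the inner series variable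
  is \<open>t\<close>, the outer one is \<open>z\<close>.
\<close>

definition tvar :: "xps fps fps" where
  "tvar = fps_const fps_X"

definition zvar :: "xps fps fps" where
  "zvar = fps_X"

definition Hgen :: "xps fps fps" where
  "Hgen = Abs_fps (\<lambda>n. fps_const (hsym n))"

definition Qgen :: "xps fps fps" where
  "Qgen = Abs_fps (\<lambda>n. Abs_fps (\<lambda>j. Qeuler n j))"

text \<open>
  The quotient by a unit of a commutative ring (the library's division on power series needs a
  coefficient type with an \<open>inverse\<close> operation).  It is meaningful only if \<open>d dvd 1\<close>.
\<close>

definition unit_quot :: "'a :: comm_ring_1 \<Rightarrow> 'a \<Rightarrow> 'a" where
  "unit_quot a d = a * (THE u. d * u = 1)"

lemma unit_quot_eq_iff:
  assumes "d dvd 1"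
  shows "q = unit_quot a d \<longleftrightarrow> q * d = a"
proof -
  obtain u where u: "d * u = 1" using assms by (metis dvdE)
  have "(THE u. d * u = 1) = u"
  proof (rule the_equality)
    show "d * u = 1" by (fact u)
    fix v assume v: "d * v = 1"
    have "v = v * (d * u)" using u by simp
    also have "\<dots> = (d * v) * u" by (simp only: ac_simps)
    finally show "v = u" using v by simp
  qed
  hence *: "unit_quot a d = a * u" by (simp add: unit_quot_def)
  have "a * u * d = a * (d * u)" "q * d * u = q * (d * u)" by (simp_all only: ac_simps)
  thus ?thesis using u * by auto
qed

end

theory Submission
  imports Defs "HOL-Library.Product_Lexorder"
begin

text \<open>
  Fix a monomial \<open>m\<close>, i.e. a weakly decreasing word, which cuts the positions \<open>1, \<dots>, n\<close> into
  blocks, one for each letter \<open>v\<close>, of size \<open>m v\<close>.  A permutation \<open>\<sigma>\<close> contributes to the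
  coefficient of \<open>m\<close> iff its barred word increases along each block, and then \<open>\<sigma>\<close> is determined by
  recording for every value its block and whether it is barred.  The admissible records are those
  in which every value is chosen independently from an explicit set, so the coefficient is
  \<open>[y\<^sup>m] \<Prod>\<^sub>v (L\<^sub>v - t y\<^sub>v) L\<^sub>v\<^bsup>m v - 1\<^esup>\<close> with \<open>L\<^sub>v = t \<Sum>\<^sub>k\<^sub>\<ge>\<^sub>v y\<^sub>k + \<Sum>\<^sub>k\<^sub>\<le>\<^sub>v y\<^sub>k\<close>.

  Let \<open>M\<close> be the series with coefficients \<open>[y\<^sup>m] \<Prod>\<^sub>v L\<^sub>v\<^bsup>m v\<^esup>\<close> and
  \<open>E(u) = \<Prod>\<^sub>v (1 - u x\<^sub>v) = 1/H(u)\<close>.  Then \<open>E(u) M\<close> has coefficients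
  \<open>[y\<^sup>m] \<Prod>\<^sub>v (L\<^sub>v - u y\<^sub>v) L\<^sub>v\<^bsup>m v - 1\<^esup>\<close>, so \<open>Q = E(t) M\<close>.  For \<open>m \<noteq> 1\<close> the product telescopes
  to \<open>\<Prod>\<^sub>v (L\<^sub>v - y\<^sub>v) = t \<Prod>\<^sub>v (L\<^sub>v - t y\<^sub>v)\<close>, whence \<open>(E(1) - t E(t)) M = 1 - t\<close>.  Multiplying
  by \<open>H(1)\<close> and \<open>E(t) H(t) = 1\<close> gives \<open>Q (H(t) - t H(1)) = (1 - t) H(1)\<close>, and \<open>z\<close> only records
  the degree.
\<close>

section \<open>Coefficients of products\<close>

lemma mcoeff_zero [simp]: "mcoeff 0 m = 0"
  and mcoeff_one: "mcoeff 1 m = (if m = {#} then 1 else 0)"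
  and mcoeff_add [simp]: "mcoeff (f + g) m = mcoeff f m + mcoeff g m"
  and mcoeff_diff [simp]: "mcoeff (f - g) m = mcoeff f m - mcoeff g m"
  and mcoeff_uminus [simp]: "mcoeff (- f) m = - mcoeff f m"
  by (simp_all add: mvps_defs)

lemma mcoeff_sum [simp]: "mcoeff (sum f A) m = (\<Sum>x\<in>A. mcoeff (f x) m)"
  by (induction A rule: infinite_finite_induct) auto

lemma mcoeff_mult: "mcoeff (f * g) m = (\<Sum>a | a \<subseteq># m. mcoeff f a * mcoeff g (m - a))"
proof -
  have "mcoeff (f * g) m = (\<Sum>p\<in>msplits m. mcoeff f (fst p) * mcoeff g (snd p))"
    by (simp add: times_mvps_def case_prod_unfold)
  also have "\<dots> = (\<Sum>a | a \<subseteq># m. mcoeff f a * mcoeff g (m - a))"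
    by (rule sum.reindex_bij_witness[of _ "\<lambda>a. (a, m - a)" fst])
      (auto simp: msplits_def intro: subset_mset.add_diff_inverse)
  finally show ?thesis .
qed

definition mmonom :: "'a::comm_ring_1 \<Rightarrow> 'v multiset \<Rightarrow> ('v, 'a) mvps" where
  "mmonom c a = Abs_mvps (\<lambda>m. if m = a then c else 0)"

lemma mcoeff_mmonom: "mcoeff (mmonom c a) m = (if m = a then c else 0)"
  by (simp add: mmonom_def)

lemma one_eq_mmonom: "1 = mmonom 1 {#}"
  by (rule mvps_eqI) (simp add: mcoeff_mmonom mcoeff_one)

lemma mcoeff_mmonom_mult:
  "mcoeff (mmonom c a * f) m = (if a \<subseteq># m then c * mcoeff f (m - a) else 0)"
proof -
  have "mcoeff (mmonom c a * f) m =
      (\<Sum>b | b \<subseteq># m. if b = a then c * mcoeff f (m - a) else 0)"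
    unfolding mcoeff_mult by (rule sum.cong) (auto simp: mcoeff_mmonom)
  thus ?thesis by (simp add: finite_submultisets)
qed

lemma mmonom_mult: "mmonom c a * mmonom d b = mmonom (c * d) (a + b)"
  by (rule mvps_eqI) (auto simp: mcoeff_mmonom_mult mcoeff_mmonom)

lemma mmonom_uminus: "mmonom (- c) a = - mmonom c a"
  by (rule mvps_eqI) (simp add: mcoeff_mmonom)

lemma mmonom_power: "mmonom c a ^ n = mmonom (c ^ n) (repeat_mset n a)"
  by (induction n) (simp_all add: one_eq_mmonom mmonom_mult)

lemma prod_mmonom: "(\<Prod>x\<in>A. mmonom (c x) (a x)) = mmonom (\<Prod>x\<in>A. c x) (\<Sum>x\<in>A. a x)"
  by (induction A rule: infinite_finite_induct) (auto simp: one_eq_mmonom mmonom_mult)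

lemma sum_singletons_eq_image_mset: "finite A \<Longrightarrow> (\<Sum>x\<in>A. {#f x#}) = image_mset f (mset_set A)"
  by (induction A rule: finite_induct) auto

lemma mcoeff_prod_sum_mmonom:
  fixes c :: "'i \<Rightarrow> 'j \<Rightarrow> 'a::comm_ring_1" and x :: "'i \<Rightarrow> 'j \<Rightarrow> 'v"
  assumes "finite I" "\<And>i. i \<in> I \<Longrightarrow> finite (J i)"
  shows "mcoeff (\<Prod>i\<in>I. \<Sum>j\<in>J i. mmonom (c i j) {#x i j#}) m =
    (\<Sum>g | g \<in> PiE I J \<and> image_mset (\<lambda>i. x i (g i)) (mset_set I) = m. \<Prod>i\<in>I. c i (g i))"
proof -
  have "(\<Prod>i\<in>I. \<Sum>j\<in>J i. mmonom (c i j) {#x i j#}) =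
      (\<Sum>g\<in>PiE I J. mmonom (\<Prod>i\<in>I. c i (g i)) (image_mset (\<lambda>i. x i (g i)) (mset_set I)))"
    using assms by (simp add: prod_sum_PiE prod_mmonom sum_singletons_eq_image_mset)
  hence "mcoeff (\<Prod>i\<in>I. \<Sum>j\<in>J i. mmonom (c i j) {#x i j#}) m =
      (\<Sum>g\<in>PiE I J. if image_mset (\<lambda>i. x i (g i)) (mset_set I) = m then \<Prod>i\<in>I. c i (g i) else 0)"
    by (simp add: mcoeff_mmonom eq_commute[of m])
  also have "\<dots> = (\<Sum>g | g \<in> PiE I J \<and> image_mset (\<lambda>i. x i (g i)) (mset_set I) = m.
      \<Prod>i\<in>I. c i (g i))"
    using assms by (intro sum.inter_filter[symmetric] finite_PiE)
  finally show ?thesis .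
qed

section \<open>Diagonal coefficients and symmetric series\<close>

definition diag_ser :: "('v \<Rightarrow> ('v, 'a::comm_ring_1) mvps) \<Rightarrow> ('v, 'a) mvps" where
  "diag_ser L = Abs_mvps (\<lambda>m. mcoeff (\<Prod>v\<in>set_mset m. L v ^ count m v) m)"

lemma mcoeff_diag_ser:
  assumes "finite T" "set_mset m \<subseteq> T"
  shows "mcoeff (diag_ser L) m = mcoeff (\<Prod>v\<in>T. L v ^ count m v) m"
proof -
  have "(\<Prod>v\<in>set_mset m. L v ^ count m v) = (\<Prod>v\<in>T. L v ^ count m v)"
    using assms by (intro prod.mono_neutral_left) (auto simp: not_in_iff)
  thus ?thesis by (simp add: diag_ser_def)
qed

definition hser :: "'a::comm_ring_1 \<Rightarrow> ('v, 'a) mvps" where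
  "hser u = Abs_mvps (\<lambda>m. u ^ size m)"

definition eser :: "'a::comm_ring_1 \<Rightarrow> ('v, 'a) mvps" where
  "eser u = Abs_mvps (\<lambda>m. if m = mset_set (set_mset m) then (- u) ^ size m else 0)"

lemma hser_eq_diag_ser: "hser u = diag_ser (\<lambda>v. mmonom u {#v#})"
proof (rule mvps_eqI)
  fix m :: "'a multiset"
  have "(\<Sum>v\<in>set_mset m. repeat_mset (count m v) {#v#}) = m"
    by (rule multiset_eqI) (simp add: count_sum not_in_iff)
  moreover have "(\<Prod>v\<in>set_mset m. u ^ count m v) = u ^ size m"
    by (simp add: size_multiset_overloaded_eq power_sum)
  ultimately show "mcoeff (hser u) m = mcoeff (diag_ser (\<lambda>v. mmonom u {#v#})) m"
    by (simp add: hser_def diag_ser_def mmonom_power prod_mmonom mcoeff_mmonom)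
qed

lemma mset_set_subseteq_mset: "S \<subseteq> set_mset m \<Longrightarrow> mset_set S \<subseteq># m"
  by (meson finite_set_mset mset_set_set_mset_msubset subset_imp_msubset_mset_set
      subset_mset.order_trans)

lemma mcoeff_eser_mult:
  "mcoeff (eser u * f) m =
     (\<Sum>S\<in>Pow (set_mset m). (- u) ^ card S * mcoeff f (m - mset_set S))"
proof -
  have inj_mset_set: "inj_on mset_set (Pow (set_mset m))"
    by (rule inj_onI) (metis PowD finite_set_mset finite_set_mset_mset_set finite_subset)
  have squarefree: "{a. a \<subseteq># m \<and> a = mset_set (set_mset a)} = mset_set ` Pow (set_mset m)"
  proof (intro equalityI subsetI)
    fix a assume "a \<in> mset_set ` Pow (set_mset m)"
    then obtain S where "S \<subseteq> set_mset m" "a = mset_set S" by blast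
    thus "a \<in> {a. a \<subseteq># m \<and> a = mset_set (set_mset a)}"
      using finite_subset[of S "set_mset m"] by (simp add: mset_set_subseteq_mset)
  qed (blast intro: set_mset_mono dest: set_mset_mono)
  have "mcoeff (eser u * f) m = (\<Sum>a | a \<subseteq># m.
      if a = mset_set (set_mset a) then (- u) ^ size a * mcoeff f (m - a) else 0)"
    unfolding mcoeff_mult by (rule sum.cong) (auto simp: eser_def)
  also have "\<dots> = (\<Sum>a\<in>mset_set ` Pow (set_mset m). (- u) ^ size a * mcoeff f (m - a))"
    using finite_submultisets[of m]
    by (subst sum.inter_filter[symmetric]) (simp_all flip: squarefree)
  also have "\<dots> = (\<Sum>S\<in>Pow (set_mset m). (- u) ^ card S * mcoeff f (m - mset_set S))"
    using inj_mset_set by (simp add: sum.reindex)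
  finally show ?thesis .
qed

lemma prod_power_count_diff_mset_set:
  fixes L :: "'v \<Rightarrow> 'r::comm_monoid_mult"
  assumes "S \<subseteq> set_mset m"
  shows "(\<Prod>v\<in>set_mset m. L v ^ count (m - mset_set S) v) =
    (\<Prod>v\<in>set_mset m - S. L v) * (\<Prod>v\<in>set_mset m. L v ^ (count m v - 1))"
proof -
  have "finite S" using assms by (rule finite_subset) simp
  hence "L v ^ count (m - mset_set S) v = (if v \<in> S then 1 else L v) * L v ^ (count m v - 1)"
    if "v \<in># m" for v
    using that by (cases "count m v") (simp_all add: count_mset_set' count_eq_zero_iff)
  hence "(\<Prod>v\<in>set_mset m. L v ^ count (m - mset_set S) v) =
      (\<Prod>v\<in>set_mset m. if v \<in> S then 1 else L v) * (\<Prod>v\<in>set_mset m. L v ^ (count m v - 1))"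
    by (simp add: prod.distrib)
  thus ?thesis by (simp add: prod.If_cases Diff_eq)
qed

text \<open>
  The term of \<open>eser u\<close> at \<open>\<Prod>\<^sub>v\<^sub>\<in>\<^sub>S x\<^sub>v\<close> is matched with the choice of \<open>- u y\<^sub>v\<close>
  from the factors with \<open>v \<in> S\<close>.
\<close>

lemma mcoeff_eser_mult_diag_ser:
  "mcoeff (eser u * diag_ser L) m =
    mcoeff (\<Prod>v\<in>set_mset m. (L v - mmonom u {#v#}) * L v ^ (count m v - 1)) m"
proof -
  let ?T = "set_mset m" and ?R = "\<Prod>v\<in>set_mset m. L v ^ (count m v - 1)"
  have subset_term: "(- u) ^ card S * mcoeff (diag_ser L) (m - mset_set S) =
      mcoeff ((\<Prod>v\<in>S. mmonom (- u) {#v#}) * (\<Prod>v\<in>?T - S. L v) * ?R) m"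
    if S: "S \<subseteq> ?T" for S
  proof -
    have "finite S" using S by (rule finite_subset) simp
    moreover have "set_mset (m - mset_set S) \<subseteq> ?T" by (meson in_diffD subsetI)
    ultimately show ?thesis
      using S prod_power_count_diff_mset_set[OF S, of L]
      by (simp add: mcoeff_diag_ser[of ?T] prod_mmonom sum_singletons_eq_image_mset
          mcoeff_mmonom_mult mset_set_subseteq_mset mult.assoc)
  qed
  have "mcoeff (eser u * diag_ser L) m =
      mcoeff (\<Sum>S\<in>Pow ?T. (\<Prod>v\<in>S. mmonom (- u) {#v#}) * (\<Prod>v\<in>?T - S. L v) * ?R) m"
    unfolding mcoeff_eser_mult mcoeff_sum by (rule sum.cong) (auto simp only: PowD subset_term)
  also have "\<dots> = mcoeff ((\<Prod>v\<in>?T. mmonom (- u) {#v#} + L v) * ?R) m"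
    by (simp add: prod_add sum_distrib_right)
  finally show ?thesis by (simp add: mmonom_uminus prod.distrib)
qed

lemma eser_mult_hser: "eser u * hser u = 1"
proof (rule mvps_eqI)
  fix m :: "'a multiset"
  show "mcoeff (eser u * hser u) m = mcoeff 1 m"
    unfolding hser_eq_diag_ser mcoeff_eser_mult_diag_ser by (auto simp: mcoeff_one power_0_left)
qed

section \<open>The linear forms attached to blocks\<close>

definition restrict_vars :: "'v set \<Rightarrow> ('v, 'a::comm_ring_1) mvps \<Rightarrow> ('v, 'a) mvps" where
  "restrict_vars V f = Abs_mvps (\<lambda>m. if set_mset m \<subseteq> V then mcoeff f m else 0)"

lemma mcoeff_restrict_vars:
  "mcoeff (restrict_vars V f) m = (if set_mset m \<subseteq> V then mcoeff f m else 0)"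
  by (simp add: restrict_vars_def)

lemma restrict_vars_one: "restrict_vars V 1 = 1"
  by (rule mvps_eqI) (simp add: mcoeff_restrict_vars mcoeff_one)

lemma restrict_vars_const: "restrict_vars V (mmonom c {#}) = mmonom c {#}"
  by (rule mvps_eqI) (simp add: mcoeff_restrict_vars mcoeff_mmonom)

lemma restrict_vars_add: "restrict_vars V (f + g) = restrict_vars V f + restrict_vars V g"
  by (rule mvps_eqI) (simp add: mcoeff_restrict_vars)

lemma restrict_vars_mult: "restrict_vars V (f * g) = restrict_vars V f * restrict_vars V g"
proof (rule mvps_eqI)
  fix m
  have "set_mset a \<subseteq> V \<and> set_mset (m - a) \<subseteq> V \<longleftrightarrow> set_mset m \<subseteq> V" if "a \<subseteq># m" for a
    using that by (metis Un_subset_iff set_mset_union subset_mset.add_diff_inverse)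
  hence "(\<Sum>a | a \<subseteq># m. mcoeff (restrict_vars V f) a * mcoeff (restrict_vars V g) (m - a)) =
      (\<Sum>a | a \<subseteq># m. if set_mset m \<subseteq> V then mcoeff f a * mcoeff g (m - a) else 0)"
    by (intro sum.cong) (auto simp: mcoeff_restrict_vars)
  thus "mcoeff (restrict_vars V (f * g)) m = mcoeff (restrict_vars V f * restrict_vars V g) m"
    by (simp add: mcoeff_mult mcoeff_restrict_vars)
qed

lemma restrict_vars_power: "restrict_vars V (f ^ n) = restrict_vars V f ^ n"
  by (induction n) (simp_all add: restrict_vars_one restrict_vars_mult)

lemma restrict_vars_prod: "restrict_vars V (prod f A) = (\<Prod>x\<in>A. restrict_vars V (f x))"
  by (induction A rule: infinite_finite_induct) (simp_all add: restrict_vars_one restrict_vars_mult)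

definition var_sum :: "'v set \<Rightarrow> ('v, 'a::comm_ring_1) mvps" where
  "var_sum U = Abs_mvps (\<lambda>m. if \<exists>k\<in>U. m = {#k#} then 1 else 0)"

lemma mcoeff_var_sum: "mcoeff (var_sum U) m = (if \<exists>k\<in>U. m = {#k#} then 1 else 0)"
  by (simp add: var_sum_def)

lemma var_sum_empty [simp]: "var_sum {} = 0"
  by (rule mvps_eqI) (simp add: mcoeff_var_sum)

lemma var_sum_insert: "v \<notin> U \<Longrightarrow> var_sum (insert v U) = mmonom 1 {#v#} + var_sum U"
  by (rule mvps_eqI) (auto simp: mcoeff_var_sum mcoeff_mmonom)

lemma var_sum_eq_sum: "finite U \<Longrightarrow> var_sum U = (\<Sum>k\<in>U. mmonom 1 {#k#})"
  by (induction U rule: finite_induct) (simp_all add: var_sum_insert)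

lemma restrict_vars_var_sum: "restrict_vars V (var_sum U) = var_sum (U \<inter> V)"
  by (rule mvps_eqI) (auto simp: mcoeff_restrict_vars mcoeff_var_sum)

text \<open>
  The coefficient of \<open>y\<^sub>k\<close> counts the ways in which a value lying in the block of \<open>v\<close>, but not its
  first element, can occur in the block of \<open>k\<close>: as a barred letter (weight \<open>t\<close>) or as a plain one
  (weight 1).  Blocks of larger letters come first, since words are weakly decreasing.
\<close>

definition block_form :: "'a::comm_ring_1 \<Rightarrow> 'v::linorder \<Rightarrow> ('v, 'a) mvps" where
  "block_form t v = mmonom t {#} * var_sum {v..} + var_sum {..v}"

lemma block_form_diff_barred:
  "block_form t v - mmonom t {#v#} = mmonom t {#} * var_sum {v<..} + var_sum {..v}"
proof -
  have "{v..} = insert v {v<..}" by auto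
  thus ?thesis by (simp add: block_form_def var_sum_insert mmonom_mult algebra_simps)
qed

lemma block_form_diff_plain:
  "block_form t v - mmonom 1 {#v#} = mmonom t {#} * var_sum {v..} + var_sum {..<v}"
proof -
  have "{..v} = insert v {..<v}" by auto
  thus ?thesis by (simp add: block_form_def var_sum_insert)
qed

text \<open>
  If \<open>v\<^sub>1 < \<dots> < v\<^sub>r\<close> are the elements of \<open>T\<close>, the strict upper set of \<open>v\<^sub>i\<close> is the weak upper
  set of \<open>v\<^sub>i\<^sub>+\<^sub>1\<close>, so the two products share all factors but one.  The common part \<open>P\<close> is exposed
  because the ring has zero divisors in general.
\<close>

lemma prod_upper_sets_telescope:
  fixes \<phi> :: "'v::linorder set \<Rightarrow> 'r::comm_monoid_mult"
  assumes "finite T" "T \<noteq> {}"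
  obtains P where "(\<Prod>v\<in>T. \<phi> (T \<inter> {v..})) = \<phi> T * P" "(\<Prod>v\<in>T. \<phi> (T \<inter> {v<..})) = \<phi> {} * P"
  using assms
proof (induction T arbitrary: thesis rule: finite_linorder_min_induct)
  case empty
  thus ?case by simp
next
  case (insert b A)
  have "b \<notin> A" using insert.hyps by auto
  moreover have "insert b A \<inter> {v..} = A \<inter> {v..}" "insert b A \<inter> {v<..} = A \<inter> {v<..}" if "v \<in> A" for v
    using insert.hyps that by auto
  moreover have "insert b A \<inter> {b..} = insert b A" "insert b A \<inter> {b<..} = A"
    using insert.hyps by auto
  ultimately have weak: "(\<Prod>v\<in>insert b A. \<phi> (insert b A \<inter> {v..})) =
      \<phi> (insert b A) * (\<Prod>v\<in>A. \<phi> (A \<inter> {v..}))"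
    and strict: "(\<Prod>v\<in>insert b A. \<phi> (insert b A \<inter> {v<..})) = \<phi> A * (\<Prod>v\<in>A. \<phi> (A \<inter> {v<..}))"
    using insert.hyps(1) by simp_all
  show ?case
  proof (cases "A = {}")
    case True
    thus ?thesis using insert.prems(1)[of 1] unfolding weak strict by simp
  next
    case False
    then obtain P where "(\<Prod>v\<in>A. \<phi> (A \<inter> {v..})) = \<phi> A * P" "(\<Prod>v\<in>A. \<phi> (A \<inter> {v<..})) = \<phi> {} * P"
      using insert.IH by blast
    thus ?thesis
      using insert.prems(1)[of "\<phi> A * P"] unfolding weak strict by (simp add: mult.left_commute)
  qed
qed

lemma restrict_vars_prod_block_form_diff:
  fixes t :: "'a::comm_ring_1" and T :: "'v::linorder set"
  assumes "finite T" "T \<noteq> {}"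
  shows "restrict_vars T (\<Prod>v\<in>T. block_form t v - mmonom 1 {#v#}) =
    mmonom t {#} * restrict_vars T (\<Prod>v\<in>T. block_form t v - mmonom t {#v#})"
proof -
  define \<phi> :: "'v set \<Rightarrow> ('v, 'a) mvps" where
    "\<phi> U = mmonom t {#} * var_sum U + var_sum (T - U)" for U
  have "{..<v} \<inter> T = T - T \<inter> {v..}" "{..v} \<inter> T = T - T \<inter> {v<..}" for v by auto
  hence "restrict_vars T (block_form t v - mmonom 1 {#v#}) = \<phi> (T \<inter> {v..})"
    and "restrict_vars T (block_form t v - mmonom t {#v#}) = \<phi> (T \<inter> {v<..})" for v
    by (simp_all add: block_form_diff_plain block_form_diff_barred \<phi>_def restrict_vars_add
        restrict_vars_mult restrict_vars_const restrict_vars_var_sum Int_commute)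
  moreover obtain P where "(\<Prod>v\<in>T. \<phi> (T \<inter> {v..})) = \<phi> T * P"
    "(\<Prod>v\<in>T. \<phi> (T \<inter> {v<..})) = \<phi> {} * P"
    using prod_upper_sets_telescope[OF assms] .
  moreover have "\<phi> T = mmonom t {#} * \<phi> {}" by (simp add: \<phi>_def)
  ultimately show ?thesis by (simp add: restrict_vars_prod mult.assoc)
qed

lemma mcoeff_restrict_vars_set_mset: "mcoeff (restrict_vars (set_mset m) f) m = mcoeff f m"
  by (simp add: mcoeff_restrict_vars)

lemma eser_diff_mult_diag_ser_block_form:
  "(eser 1 - mmonom t {#} * eser t) * diag_ser (block_form t) = 1 - mmonom t {#}"
proof (rule mvps_eqI)
  fix m :: "'a multiset"
  let ?M = "diag_ser (block_form t)" and ?T = "set_mset m"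
  have "mcoeff (eser 1 * ?M) m = t * mcoeff (eser t * ?M) m" if "m \<noteq> {#}"
  proof -
    let ?R = "\<Prod>v\<in>?T. block_form t v ^ (count m v - 1)"
    let ?D = "\<lambda>u. \<Prod>v\<in>?T. block_form t v - mmonom u {#v#}"
    have mcoeff_eser: "mcoeff (eser u * ?M) m =
        mcoeff (restrict_vars ?T (?D u) * restrict_vars ?T ?R) m" for u
      by (simp add: mcoeff_eser_mult_diag_ser prod.distrib mcoeff_restrict_vars_set_mset
          flip: restrict_vars_mult)
    have "restrict_vars ?T (?D 1) = mmonom t {#} * restrict_vars ?T (?D t)"
      using that by (intro restrict_vars_prod_block_form_diff) auto
    thus ?thesis by (simp add: mcoeff_eser mult.assoc mcoeff_mmonom_mult)
  qed
  thus "mcoeff ((eser 1 - mmonom t {#} * eser t) * ?M) m = mcoeff (1 - mmonom t {#}) m"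
    by (cases "m = {#}")
      (simp_all add: left_diff_distrib mult.assoc mcoeff_mmonom_mult mcoeff_eser_mult_diag_ser
        mcoeff_mmonom mcoeff_one)
qed

lemma eser_mult_diag_ser_block_form_mult_hser_diff:
  "eser t * diag_ser (block_form t) * (hser t - mmonom t {#} * hser 1) =
    (1 - mmonom t {#}) * hser 1"
proof -
  let ?M = "diag_ser (block_form t)" and ?t = "mmonom t {#}"
  have "eser t * ?M * (hser t - ?t * hser 1) = ?M * (eser t * hser t) - ?t * eser t * ?M * hser 1"
    by (simp add: algebra_simps)
  also have "\<dots> = ?M * (eser 1 * hser 1) - ?t * eser t * ?M * hser 1"
    by (simp add: eser_mult_hser)
  also have "\<dots> = ((eser 1 - ?t * eser t) * ?M) * hser 1"
    by (simp add: algebra_simps)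
  also have "\<dots> = (1 - ?t) * hser 1"
    by (simp only: eser_diff_mult_diag_ser_block_form)
  finally show ?thesis .
qed

section \<open>Antitone functions and sorting permutations\<close>

lemma antimono_on_atLeastAtMost_iff_Suc:
  fixes f :: "nat \<Rightarrow> 'a::order"
  shows "antimono_on {a..b} f \<longleftrightarrow> (\<forall>i\<in>{a..<b}. f (Suc i) \<le> f i)"
proof
  assume step: "\<forall>i\<in>{a..<b}. f (Suc i) \<le> f i"
  show "antimono_on {a..b} f"
    by (rule monotone_onI, rule lift_Suc_antimono_le_ivl[of "{a..<b}"]) (use step in auto)
qed (auto simp: monotone_on_def)

lemma antimono_on_eqI:
  fixes f g :: "'a::linorder \<Rightarrow> 'b::linorder"
  assumes "finite A" "antimono_on A f" "antimono_on A g"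
    and "image_mset f (mset_set A) = image_mset g (mset_set A)"
    and "x \<in> A"
  shows "f x = g x"
proof -
  let ?xs = "sorted_list_of_set A"
  have set_xs: "set ?xs = A" using assms(1) by simp
  have mset_xs: "mset ?xs = mset_set A"
    by (metis mset_sorted_list_of_multiset sorted_list_of_mset_set)
  have "sorted (rev (map h ?xs))" if "antimono_on A h" for h :: "'a \<Rightarrow> 'b"
    unfolding sorted_rev_iff_nth_mono
  proof (intro allI impI)
    fix i j assume "i \<le> j" "j < length (map h ?xs)"
    moreover from this have "?xs ! i \<in> A" "?xs ! j \<in> A"
      using set_xs nth_mem[of i ?xs] nth_mem[of j ?xs] by auto
    ultimately show "map h ?xs ! j \<le> map h ?xs ! i"
      using monotone_onD[OF that, of "?xs ! i" "?xs ! j"] sorted_nth_mono[of ?xs i j] by simp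
  qed
  moreover have "mset (rev (map f ?xs)) = mset (rev (map g ?xs))"
    using assms(4) mset_xs by simp
  ultimately have "rev (map f ?xs) = rev (map g ?xs)"
    using assms(2,3) by (metis properties_for_sort)
  thus ?thesis using assms(5) set_xs by (simp add: map_eq_conv)
qed

lemma antimono_on_image_atLeastAtMost:
  fixes f :: "'a::linorder \<Rightarrow> 'b::linorder"
  assumes "antimono_on {a..b} f" "x \<in> {a..b}"
  shows "f ` {x..b} = f ` {a..b} \<inter> {..f x}"
proof (intro equalityI subsetI)
  fix k assume "k \<in> f ` {a..b} \<inter> {..f x}"
  then obtain y where y: "y \<in> {a..b}" "k = f y" "f y \<le> f x" by auto
  show "k \<in> f ` {x..b}"
  proof (cases "x \<le> y")
    case False
    hence "f y = f x" using y assms by (auto simp: monotone_on_def intro: antisym)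
    thus ?thesis using y assms(2) by (intro image_eqI[of _ _ x]) auto
  qed (use y in auto)
qed (use assms in \<open>auto simp: monotone_on_def\<close>)

lemma antimono_on_image_atLeastLessThan:
  fixes f :: "'a::linorder \<Rightarrow> 'b::linorder"
  assumes "antimono_on {a..b} f" "x \<in> {a..b}"
  shows "f ` {a..<x} = f ` {a..b} \<inter> (if f x \<in> f ` {a..<x} then {f x..} else {f x<..})"
proof (intro equalityI subsetI)
  fix k assume k: "k \<in> f ` {a..<x}"
  hence "f x \<le> k" "k \<in> f ` {a..b}" using assms by (auto simp: monotone_on_def)
  thus "k \<in> f ` {a..b} \<inter> (if f x \<in> f ` {a..<x} then {f x..} else {f x<..})"
    using k by (cases "f x = k") (simp_all add: order.not_eq_order_implies_strict)
next
  fix k assume k: "k \<in> f ` {a..b} \<inter> (if f x \<in> f ` {a..<x} then {f x..} else {f x<..})"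
  then obtain y where y: "y \<in> {a..b}" "k = f y" by auto
  show "k \<in> f ` {a..<x}"
  proof (cases "f x < k")
    case True
    hence "\<not> x \<le> y" using y assms by (force simp: monotone_on_def)
    thus ?thesis using y by auto
  qed (use k in \<open>auto split: if_splits\<close>)
qed

lemma image_mset_permutes:
  assumes "\<sigma> permutes A"
  shows "image_mset (\<lambda>i. f (\<sigma> i)) (mset_set A) = image_mset f (mset_set A)"
  using permutes_image_mset[OF assms] by (metis comp_apply multiset.map_comp multiset.map_cong0)

lemma ex_permutes_antimono_on:
  fixes f :: "nat \<Rightarrow> 'a::linorder"
  shows "\<exists>\<sigma>. \<sigma> permutes {1..n} \<and> antimono_on {1..n} (\<lambda>i. f (\<sigma> i))"
proof -
  define xs where "xs = rev (sort_key f [1..<Suc n])"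
  define \<sigma> where "\<sigma> i = (if i \<in> {1..n} then xs ! (i - 1) else i)" for i
  have length_xs: "length xs = n" by (simp add: xs_def)
  have "bij_betw ((!) xs) {..<n} {1..n}"
    by (rule bij_betw_nth)
      (simp_all add: length_xs xs_def atLeastLessThanSuc_atLeastAtMost del: upt_Suc)
  moreover have "bij_betw (\<lambda>i. i - 1) {1..n} {..<n}"
    by (rule bij_betw_byWitness[of _ Suc]) auto
  ultimately have "bij_betw ((!) xs \<circ> (\<lambda>i. i - 1)) {1..n} {1..n}"
    by (rule bij_betw_trans[rotated])
  hence "bij_betw \<sigma> {1..n} {1..n}"
    by (rule bij_betw_cong[THEN iffD1, rotated]) (simp add: \<sigma>_def)
  hence perm: "\<sigma> permutes {1..n}" by (rule bij_imp_permutes) (auto simp: \<sigma>_def)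
  have "sorted (rev (map f xs))" by (simp add: xs_def rev_map)
  hence "antimono_on {1..n} (\<lambda>i. f (\<sigma> i))"
    by (auto simp: monotone_on_def \<sigma>_def sorted_rev_iff_nth_mono length_xs)
  with perm show ?thesis by blast
qed

section \<open>Permutations compatible with a word\<close>

definition exd_compatible :: "nat \<Rightarrow> (nat \<Rightarrow> 'v::linorder) \<Rightarrow> (nat \<Rightarrow> nat) \<Rightarrow> bool" where
  "exd_compatible n w \<sigma> \<longleftrightarrow> (\<forall>j\<in>EXD n \<sigma>. w (j + 1) < w j)"

definition exd_compatible_perms :: "nat \<Rightarrow> (nat \<Rightarrow> 'v::linorder) \<Rightarrow> (nat \<Rightarrow> nat) set" where
  "exd_compatible_perms n w = {\<sigma>. \<sigma> permutes {1..n} \<and> exd_compatible n w \<sigma>}"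

lemma not_bar_word_less_iff:
  "\<not> letter_less (bar_word \<sigma> j) (bar_word \<sigma> i) \<longleftrightarrow>
     (j < \<sigma> j, - int (\<sigma> j)) \<le> (i < \<sigma> i, - int (\<sigma> i))"
  by (auto simp: bar_word_def)

lemma exd_compatible_iff_antimono_on:
  fixes w :: "nat \<Rightarrow> 'v::linorder"
  assumes "antimono_on {1..n} w"
  shows "exd_compatible n w \<sigma> \<longleftrightarrow> antimono_on {1..n} (\<lambda>i. (w i, i < \<sigma> i, - int (\<sigma> i)))"
proof -
  let ?key = "\<lambda>i. (w i, i < \<sigma> i, - int (\<sigma> i))"
  have "(letter_less (bar_word \<sigma> (Suc i)) (bar_word \<sigma> i) \<longrightarrow> w (Suc i) < w i) \<longleftrightarrow>
      ?key (Suc i) \<le> ?key i" if "i \<in> {1..<n}" for i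
  proof -
    have "w (Suc i) \<le> w i" using assms that by (auto simp: monotone_on_def)
    thus ?thesis
      using not_bar_word_less_iff[of \<sigma> "Suc i" i]
      unfolding less_eq_prod_simp[of "w (Suc i)"] by auto
  qed
  hence "(\<forall>i\<in>{1..<n}. letter_less (bar_word \<sigma> (Suc i)) (bar_word \<sigma> i) \<longrightarrow> w (Suc i) < w i) \<longleftrightarrow>
      antimono_on {1..n} ?key"
    unfolding antimono_on_atLeastAtMost_iff_Suc by (intro ball_cong refl)
  thus ?thesis by (auto simp: exd_compatible_def EXD_def)
qed

definition value_code :: "nat \<Rightarrow> (nat \<Rightarrow> 'v) \<Rightarrow> (nat \<Rightarrow> nat) \<Rightarrow> nat \<Rightarrow> 'v \<times> bool" where
  "value_code n w \<sigma> = (\<lambda>p\<in>{1..n}. (w (inv \<sigma> p), inv \<sigma> p < p))"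

text \<open>
  Only some position of the chosen block has to lie before a barred value \<open>p\<close>, or at or after a
  plain one: since barred letters come first in a block and each kind increases along it, this
  already forces every barred letter to be an excedance and every plain one not to be.
\<close>

definition value_choices :: "nat \<Rightarrow> (nat \<Rightarrow> 'v) \<Rightarrow> nat \<Rightarrow> ('v \<times> bool) set" where
  "value_choices n w p = w ` {1..<p} \<times> {True} \<union> w ` {p..n} \<times> {False}"

definition value_codes :: "nat \<Rightarrow> (nat \<Rightarrow> 'v) \<Rightarrow> (nat \<Rightarrow> 'v \<times> bool) set" where
  "value_codes n w = {g. g \<in> PiE {1..n} (value_choices n w) \<and>
     image_mset (\<lambda>p. fst (g p)) (mset_set {1..n}) = image_mset w (mset_set {1..n})}"

text \<open>
  Along a compatible permutation the blocks decrease, barred letters precede plain ones, and the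
  values of each kind increase; negating the values makes all three components antitone.
\<close>

definition code_key :: "(nat \<Rightarrow> 'v \<times> bool) \<Rightarrow> nat \<Rightarrow> 'v \<times> bool \<times> int" where
  "code_key g p = (fst (g p), snd (g p), - int p)"

lemma value_code_apply:
  assumes "\<sigma> permutes {1..n}" "i \<in> {1..n}"
  shows "value_code n w \<sigma> (\<sigma> i) = (w i, i < \<sigma> i)"
  using assms permutes_in_image[OF assms(1), of i] by (simp add: value_code_def permutes_inverses)

lemma exd_compatible_iff_antimono_on_code_key:
  fixes w :: "nat \<Rightarrow> 'v::linorder"
  assumes "antimono_on {1..n} w" "\<sigma> permutes {1..n}"
  shows "exd_compatible n w \<sigma> \<longleftrightarrow> antimono_on {1..n} (\<lambda>i. code_key (value_code n w \<sigma>) (\<sigma> i))"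
  unfolding exd_compatible_iff_antimono_on[OF assms(1)]
  by (simp add: monotone_on_def code_key_def value_code_apply[OF assms(2)]
      del: One_nat_def less_eq_prod_simp)

lemma inj_on_value_code:
  fixes w :: "nat \<Rightarrow> 'v::linorder"
  assumes w: "antimono_on {1..n} w"
  shows "inj_on (value_code n w) (exd_compatible_perms n w)"
proof (rule inj_onI)
  fix \<sigma> \<tau>
  assume \<sigma>: "\<sigma> \<in> exd_compatible_perms n w"
    and \<tau>: "\<tau> \<in> exd_compatible_perms n w"
    and code_eq: "value_code n w \<sigma> = value_code n w \<tau>"
  let ?key = "code_key (value_code n w \<sigma>)"
  have "?key (\<sigma> i) = ?key (\<tau> i)" if "i \<in> {1..n}" for i
  proof (rule antimono_on_eqI[OF _ _ _ _ that])
    show "antimono_on {1..n} (\<lambda>i. ?key (\<sigma> i))" "antimono_on {1..n} (\<lambda>i. ?key (\<tau> i))"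
      using \<sigma> \<tau> code_eq exd_compatible_iff_antimono_on_code_key[OF w]
      by (auto simp: exd_compatible_perms_def)
    show "image_mset (\<lambda>i. ?key (\<sigma> i)) (mset_set {1..n}) =
        image_mset (\<lambda>i. ?key (\<tau> i)) (mset_set {1..n})"
      using \<sigma> \<tau> by (simp add: image_mset_permutes exd_compatible_perms_def)
  qed simp
  moreover have "\<sigma> i = \<tau> i" if "i \<notin> {1..n}" for i
    using that \<sigma> \<tau> by (auto simp: exd_compatible_perms_def permutes_def)
  ultimately show "\<sigma> = \<tau>" by (fastforce simp: code_key_def)
qed

lemma value_code_in_value_codes:
  assumes "\<sigma> permutes {1..n}"
  shows "value_code n w \<sigma> \<in> value_codes n w"
proof -
  have "value_code n w \<sigma> \<in> PiE {1..n} (value_choices n w)"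
  proof (rule PiE_I)
    fix p assume "p \<in> {1..n}"
    hence "inv \<sigma> p \<in> {1..n}" using permutes_in_image[OF permutes_inv[OF assms]] by blast
    thus "value_code n w \<sigma> p \<in> value_choices n w p"
      using \<open>p \<in> {1..n}\<close> by (cases "inv \<sigma> p < p") (auto simp: value_code_def value_choices_def)
  qed (auto simp: value_code_def)
  moreover have "image_mset (\<lambda>p. fst (value_code n w \<sigma> p)) (mset_set {1..n}) =
      image_mset (\<lambda>p. w (inv \<sigma> p)) (mset_set {1..n})"
    by (rule image_mset_cong) (simp add: value_code_def)
  ultimately show ?thesis
    unfolding value_codes_def image_mset_permutes[OF permutes_inv[OF assms]] by blast
qed

lemma antimono_key_Suc_in_block:
  fixes w :: "nat \<Rightarrow> 'v::linorder"
  assumes "antimono_on {1..n} (\<lambda>i. (w i, b i, - int (\<sigma> i)))" "inj_on \<sigma> {1..n}"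
    and "i \<in> {1..n}" "Suc i \<in> {1..n}" "w i = w (Suc i)"
  shows "b (Suc i) \<Longrightarrow> b i" and "b i = b (Suc i) \<Longrightarrow> \<sigma> i < \<sigma> (Suc i)"
proof -
  have "(w (Suc i), b (Suc i), - int (\<sigma> (Suc i))) \<le> (w i, b i, - int (\<sigma> i))"
    using monotone_onD[OF assms(1,3,4)] by simp
  moreover have "\<sigma> i \<noteq> \<sigma> (Suc i)"
    using inj_onD[OF assms(2) _ assms(3,4)] by auto
  ultimately show "b (Suc i) \<Longrightarrow> b i" and "b i = b (Suc i) \<Longrightarrow> \<sigma> i < \<sigma> (Suc i)"
    using assms(5) by auto
qed

lemma barred_imp_excedance:
  fixes w :: "nat \<Rightarrow> 'v::linorder"
  assumes w: "antimono_on {1..n} w"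
    and antimono_key: "antimono_on {1..n} (\<lambda>i. (w i, b i, - int (\<sigma> i)))" "inj_on \<sigma> {1..n}"
    and choices: "\<And>i. i \<in> {1..n} \<Longrightarrow> (w i, b i) \<in> value_choices n w (\<sigma> i)"
  shows "i \<in> {1..n} \<Longrightarrow> b i \<Longrightarrow> i < \<sigma> i"
proof (induction i)
  case (Suc i)
  then obtain j where j: "1 \<le> j" "j < \<sigma> (Suc i)" "w j = w (Suc i)"
    using choices[of "Suc i"] by (auto simp: value_choices_def)
  show ?case
  proof (cases "j \<le> i")
    case True
    hence i: "i \<in> {1..n}" and "j \<in> {1..n}" using j Suc.prems(1) by auto
    hence "w (Suc i) \<le> w i" "w i \<le> w j"
      using monotone_onD[OF w i Suc.prems(1)] monotone_onD[OF w _ i True] by auto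
    hence "w i = w (Suc i)" using j by simp
    thus ?thesis
      using antimono_key_Suc_in_block[OF antimono_key i Suc.prems(1)] Suc.IH[OF i] Suc.prems(2)
      by simp
  qed (use j in simp)
qed simp

lemma plain_imp_not_excedance:
  fixes w :: "nat \<Rightarrow> 'v::linorder"
  assumes w: "antimono_on {1..n} w"
    and antimono_key: "antimono_on {1..n} (\<lambda>i. (w i, b i, - int (\<sigma> i)))" "inj_on \<sigma> {1..n}"
    and choices: "\<And>i. i \<in> {1..n} \<Longrightarrow> (w i, b i) \<in> value_choices n w (\<sigma> i)"
    and "i \<in> {1..n}" "\<not> b i"
  shows "\<sigma> i \<le> i"
proof -
  have "i \<le> n" using assms(5) by simp
  thus ?thesis using assms(5,6)
  proof (induction i rule: inc_induct)
    case base
    thus ?case using choices[of n] by (auto simp: value_choices_def)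
  next
    case (step i)
    then obtain j where j: "\<sigma> i \<le> j" "j \<le> n" "w j = w i"
      using choices[of i] by (auto simp: value_choices_def)
    show ?case
    proof (cases "i < j")
      case True
      hence Suc_i: "Suc i \<in> {1..n}" and "j \<in> {1..n}" using j step.prems(1) by auto
      hence "w (Suc i) \<le> w i" "w j \<le> w (Suc i)"
        using monotone_onD[OF w step.prems(1) Suc_i] monotone_onD[OF w Suc_i] True by auto
      hence "w i = w (Suc i)" using j by simp
      thus ?thesis
        using antimono_key_Suc_in_block[OF antimono_key step.prems(1) Suc_i] step.IH[OF Suc_i]
          step.prems(2) by fastforce
    qed (use j in simp)
  qed
qed

lemma fst_sorted_value_code:
  fixes w :: "nat \<Rightarrow> 'v::linorder"
  assumes w: "antimono_on {1..n} w" and g: "g \<in> value_codes n w" and \<sigma>: "\<sigma> permutes {1..n}"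
    and antimono_key: "antimono_on {1..n} (\<lambda>i. code_key g (\<sigma> i))" and i: "i \<in> {1..n}"
  shows "fst (g (\<sigma> i)) = w i"
proof (rule antimono_on_eqI[OF _ _ w _ i])
  have "fst (g p) \<le> fst (g q)" if "code_key g p \<le> code_key g q" for p q
    using that by (auto simp: code_key_def)
  thus "antimono_on {1..n} (\<lambda>i. fst (g (\<sigma> i)))"
    using antimono_key by (simp add: monotone_on_def)
  show "image_mset (\<lambda>i. fst (g (\<sigma> i))) (mset_set {1..n}) = image_mset w (mset_set {1..n})"
    using g image_mset_permutes[OF \<sigma>, of "\<lambda>p. fst (g p)"] by (simp add: value_codes_def)
qed simp

lemma snd_sorted_value_code:
  fixes w :: "nat \<Rightarrow> 'v::linorder"
  assumes w: "antimono_on {1..n} w" and g: "g \<in> value_codes n w" and \<sigma>: "\<sigma> permutes {1..n}"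
    and antimono_key: "antimono_on {1..n} (\<lambda>i. code_key g (\<sigma> i))" and i: "i \<in> {1..n}"
  shows "snd (g (\<sigma> i)) \<longleftrightarrow> i < \<sigma> i"
proof -
  note block_eq = fst_sorted_value_code[OF w g \<sigma> antimono_key]
  have in_choices: "(w i, snd (g (\<sigma> i))) \<in> value_choices n w (\<sigma> i)" if "i \<in> {1..n}" for i
  proof -
    have "\<sigma> i \<in> {1..n}" using that permutes_in_image[OF \<sigma>] by blast
    hence "g (\<sigma> i) \<in> value_choices n w (\<sigma> i)" using g by (auto simp: value_codes_def)
    thus ?thesis using block_eq[OF that] by (metis prod.collapse)
  qed
  have antimono_key_w: "antimono_on {1..n} (\<lambda>i. (w i, snd (g (\<sigma> i)), - int (\<sigma> i)))"
    using antimono_key block_eq by (simp add: monotone_on_def code_key_def)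
  show ?thesis
    using barred_imp_excedance[OF w antimono_key_w permutes_inj_on[OF \<sigma>] in_choices i]
      plain_imp_not_excedance[OF w antimono_key_w permutes_inj_on[OF \<sigma>] in_choices i]
    by linarith
qed

lemma ex_exd_compatible_value_code:
  fixes w :: "nat \<Rightarrow> 'v::linorder"
  assumes w: "antimono_on {1..n} w" and g: "g \<in> value_codes n w"
  shows "\<exists>\<sigma>\<in>exd_compatible_perms n w. value_code n w \<sigma> = g"
proof -
  obtain \<sigma> where \<sigma>: "\<sigma> permutes {1..n}"
    and antimono_key: "antimono_on {1..n} (\<lambda>i. code_key g (\<sigma> i))"
    using ex_permutes_antimono_on by blast
  have code_eq: "value_code n w \<sigma> = g"
  proof (rule PiE_ext)
    show "value_code n w \<sigma> \<in> PiE {1..n} (value_choices n w)" "g \<in> PiE {1..n} (value_choices n w)"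
      using value_code_in_value_codes[OF \<sigma>, of w] g
      by (simp_all only: value_codes_def mem_Collect_eq)
  next
    fix p assume "p \<in> {1..n}"
    then obtain i where "i \<in> {1..n}" "p = \<sigma> i" using permutes_image[OF \<sigma>] by blast
    thus "value_code n w \<sigma> p = g p"
      using fst_sorted_value_code[OF w g \<sigma> antimono_key]
        snd_sorted_value_code[OF w g \<sigma> antimono_key]
      by (simp add: value_code_apply[OF \<sigma>] prod_eq_iff)
  qed
  moreover have "exd_compatible n w \<sigma>"
    using antimono_key code_eq by (simp add: exd_compatible_iff_antimono_on_code_key[OF w \<sigma>])
  ultimately show ?thesis using \<sigma> by (auto simp: exd_compatible_perms_def)
qed

lemma bij_betw_value_code:
  fixes w :: "nat \<Rightarrow> 'v::linorder"
  assumes "antimono_on {1..n} w"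
  shows "bij_betw (value_code n w) (exd_compatible_perms n w) (value_codes n w)"
  using inj_on_value_code[OF assms] ex_exd_compatible_value_code[OF assms] value_code_in_value_codes
  by (force simp: bij_betw_def exd_compatible_perms_def)

lemma card_value_code_barred:
  assumes "\<sigma> permutes {1..n}"
  shows "card {p \<in> {1..n}. snd (value_code n w \<sigma> p)} = exc n \<sigma>"
proof -
  have "\<sigma> i \<le> n" if "i \<in> {1..n}" for i using permutes_in_image[OF assms, of i] that by simp
  hence "{i \<in> {1..<n}. i < \<sigma> i} = {i \<in> {1..n}. i < \<sigma> i}" by fastforce
  moreover have "{p \<in> \<sigma> ` {1..n}. snd (value_code n w \<sigma> p)} = \<sigma> ` {i \<in> {1..n}. i < \<sigma> i}"
    by (auto simp: value_code_apply[OF assms] simp del: One_nat_def)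
  ultimately show ?thesis
    unfolding permutes_image[OF assms] by (simp add: exc_def card_image permutes_inj_on[OF assms])
qed

section \<open>The generating function of compatible permutations\<close>

definition value_form :: "'a::comm_ring_1 \<Rightarrow> nat \<Rightarrow> (nat \<Rightarrow> 'v) \<Rightarrow> nat \<Rightarrow> ('v, 'a) mvps" where
  "value_form t n w p = mmonom t {#} * var_sum (w ` {1..<p}) + var_sum (w ` {p..n})"

lemma sum_value_choices_eq_value_form:
  "(\<Sum>c\<in>value_choices n w p. mmonom (if snd c then t else 1) {#fst c#}) = value_form t n w p"
proof -
  let ?f = "\<lambda>c. mmonom (if snd c then t else 1) {#fst c#}"
  have "(\<Sum>c\<in>value_choices n w p. ?f c) =
      (\<Sum>c\<in>w ` {1..<p} \<times> {True}. ?f c) + (\<Sum>c\<in>w ` {p..n} \<times> {False}. ?f c)"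
    unfolding value_choices_def by (rule sum.union_disjoint) auto
  also have "\<dots> = (\<Sum>k\<in>w ` {1..<p}. mmonom t {#k#}) + (\<Sum>k\<in>w ` {p..n}. mmonom 1 {#k#})"
    by (simp add: sum.cartesian_product')
  finally show ?thesis
    by (simp add: value_form_def var_sum_eq_sum sum_distrib_left mmonom_mult)
qed

lemma sum_power_exc_eq_mcoeff_prod:
  fixes t :: "'a::comm_ring_1" and w :: "nat \<Rightarrow> 'v::linorder"
  assumes "antimono_on {1..n} w"
  shows "(\<Sum>\<sigma>\<in>exd_compatible_perms n w. t ^ exc n \<sigma>) =
    mcoeff (\<Prod>p\<in>{1..n}. value_form t n w p) (image_mset w (mset_set {1..n}))"
proof -
  have weight: "(\<Prod>p\<in>{1..n}. if snd (value_code n w \<sigma> p) then t else 1) = t ^ exc n \<sigma>"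
    if "\<sigma> permutes {1..n}" for \<sigma>
    using card_value_code_barred[OF that, of w] by (simp flip: prod.inter_filter)
  have "mcoeff (\<Prod>p\<in>{1..n}. value_form t n w p) (image_mset w (mset_set {1..n})) =
      (\<Sum>g\<in>value_codes n w. \<Prod>p\<in>{1..n}. if snd (g p) then t else 1)"
    unfolding sum_value_choices_eq_value_form[symmetric] value_codes_def
    by (rule mcoeff_prod_sum_mmonom) (auto simp: value_choices_def)
  also have "\<dots> = (\<Sum>\<sigma>\<in>exd_compatible_perms n w.
      \<Prod>p\<in>{1..n}. if snd (value_code n w \<sigma> p) then t else 1)"
    by (rule sum.reindex_bij_betw[OF bij_betw_value_code[OF assms], symmetric])
  also have "\<dots> = (\<Sum>\<sigma>\<in>exd_compatible_perms n w. t ^ exc n \<sigma>)"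
    by (rule sum.cong[OF refl]) (use weight in \<open>simp add: exd_compatible_perms_def\<close>)
  finally show ?thesis ..
qed

lemma value_form_eq_restrict_vars:
  fixes t :: "'a::comm_ring_1" and w :: "nat \<Rightarrow> 'v::linorder"
  assumes "antimono_on {1..n} w" "p \<in> {1..n}"
  shows "value_form t n w p = restrict_vars (w ` {1..n})
      (block_form t (w p) - (if w p \<in> w ` {1..<p} then 0 else mmonom t {#w p#}))"
proof -
  have "block_form t (w p) - (if w p \<in> w ` {1..<p} then 0 else mmonom t {#w p#}) =
      mmonom t {#} * var_sum (if w p \<in> w ` {1..<p} then {w p..} else {w p<..}) + var_sum {..w p}"
    by (simp add: block_form_diff_barred) (simp add: block_form_def)
  thus ?thesis
    using antimono_on_image_atLeastLessThan[OF assms] antimono_on_image_atLeastAtMost[OF assms]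
    by (simp add: value_form_def restrict_vars_add restrict_vars_mult restrict_vars_const
        restrict_vars_var_sum Int_commute)
qed

lemma prod_value_form_block:
  fixes t :: "'a::comm_ring_1" and w :: "nat \<Rightarrow> 'v::linorder"
  assumes w: "antimono_on {1..n} w" and v: "v \<in> w ` {1..n}"
  shows "(\<Prod>p | p \<in> {1..n} \<and> w p = v. value_form t n w p) =
    restrict_vars (w ` {1..n}) ((block_form t v - mmonom t {#v#}) *
      block_form t v ^ (count (image_mset w (mset_set {1..n})) v - 1))"
proof -
  let ?T = "w ` {1..n}" and ?X = "value_form t n w"
  define P where "P = {p. p \<in> {1..n} \<and> w p = v}"
  have finite_P: "finite P" and "P \<noteq> {}"
    using v by (auto simp: P_def)
  hence Min_in_P: "Min P \<in> P" by (rule Min_in)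
  have P_iff: "p \<in> P \<longleftrightarrow> p \<in> {1..n} \<and> w p = v" for p by (simp add: P_def)
  have count_eq: "count (image_mset w (mset_set {1..n})) v = card P"
    by (simp add: count_image_mset' P_def eq_commute[of v])
  have form_first: "?X (Min P) = restrict_vars ?T (block_form t v - mmonom t {#v#})"
  proof -
    have "i \<notin> P" if "i < Min P" for i using that Min_le[OF finite_P, of i] by auto
    hence "v \<notin> w ` {1..<Min P}" using Min_in_P by (fastforce simp: P_iff)
    thus ?thesis using Min_in_P value_form_eq_restrict_vars[OF w, of "Min P" t] by (simp add: P_iff)
  qed
  have form_other: "?X p = restrict_vars ?T (block_form t v)" if "p \<in> P - {Min P}" for p
  proof -
    have "Min P \<in> {1..<p}" using that Min_in_P Min_le[OF finite_P, of p] by (auto simp: P_iff)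
    hence "v \<in> w ` {1..<p}" using Min_in_P by (auto simp: P_iff)
    thus ?thesis using that value_form_eq_restrict_vars[OF w, of p t] by (simp add: P_iff)
  qed
  have "(\<Prod>p\<in>P. ?X p) = ?X (Min P) * (\<Prod>p\<in>P - {Min P}. ?X p)"
    using finite_P Min_in_P by (rule prod.remove)
  also have "(\<Prod>p\<in>P - {Min P}. ?X p) = restrict_vars ?T (block_form t v) ^ (card P - 1)"
    using form_other finite_P Min_in_P by simp
  finally show ?thesis
    unfolding P_def[symmetric] count_eq form_first
    by (simp add: restrict_vars_mult restrict_vars_power)
qed

lemma sum_power_exc_eq_mcoeff:
  fixes t :: "'a::comm_ring_1" and w :: "nat \<Rightarrow> 'v::linorder"
  assumes w: "antimono_on {1..n} w"
  shows "(\<Sum>\<sigma>\<in>exd_compatible_perms n w. t ^ exc n \<sigma>) =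
    mcoeff (eser t * diag_ser (block_form t)) (image_mset w (mset_set {1..n}))"
proof -
  let ?m = "image_mset w (mset_set {1..n})"
  have set_mset_eq: "set_mset ?m = w ` {1..n}" by simp
  have "(\<Prod>p\<in>{1..n}. value_form t n w p) =
      (\<Prod>v\<in>w ` {1..n}. \<Prod>p | p \<in> {1..n} \<and> w p = v. value_form t n w p)"
    by (rule prod.group[symmetric]) auto
  also have "\<dots> = restrict_vars (w ` {1..n})
      (\<Prod>v\<in>w ` {1..n}. (block_form t v - mmonom t {#v#}) * block_form t v ^ (count ?m v - 1))"
    unfolding restrict_vars_prod by (rule prod.cong[OF refl prod_value_form_block[OF w]])
  finally show ?thesis
    unfolding sum_power_exc_eq_mcoeff_prod[OF w] mcoeff_eser_mult_diag_ser
    using mcoeff_restrict_vars_set_mset[of ?m] by (simp only: set_mset_eq)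
qed

section \<open>Transfer to series in t and z\<close>

text \<open>The substitution \<open>x\<^sub>v \<mapsto> z x\<^sub>v\<close> for \<open>v \<ge> 1\<close> and \<open>x\<^sub>0 \<mapsto> 0\<close>.\<close>

definition graded_ser :: "(nat, int fps) mvps \<Rightarrow> xps fps fps" where
  "graded_ser f = Abs_fps (\<lambda>n. Abs_fps (\<lambda>j. Abs_mvps (\<lambda>m.
     if size m = n \<and> 0 \<notin># m then fps_nth (mcoeff f m) j else 0)))"

lemma mcoeff_graded_ser:
  "mcoeff (fps_nth (fps_nth (graded_ser f) n) j) m =
     (if size m = n \<and> 0 \<notin># m then fps_nth (mcoeff f m) j else 0)"
  by (simp add: graded_ser_def)

lemma mvps_fps_fps_eqI:
  assumes "\<And>n j m. mcoeff (fps_nth (fps_nth F n) j) m = mcoeff (fps_nth (fps_nth G n) j) m"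
  shows "F = (G :: ('v, 'a::comm_ring_1) mvps fps fps)"
  by (intro fps_ext mvps_eqI assms)

lemma graded_ser_diff: "graded_ser (f - g) = graded_ser f - graded_ser g"
  by (rule mvps_fps_fps_eqI) (simp add: mcoeff_graded_ser)

lemma graded_ser_one: "graded_ser 1 = 1"
  by (rule mvps_fps_fps_eqI) (auto simp: mcoeff_graded_ser mcoeff_one)

lemma mcoeff_fps_fps_mult:
  "mcoeff (fps_nth (fps_nth (F * G) n) j) m = (\<Sum>a | a \<subseteq># m. \<Sum>i=0..j. \<Sum>k=0..n.
     mcoeff (fps_nth (fps_nth F k) i) a * mcoeff (fps_nth (fps_nth G (n - k)) (j - i)) (m - a))"
proof -
  let ?c = "\<lambda>k i a. mcoeff (fps_nth (fps_nth F k) i) a *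
    mcoeff (fps_nth (fps_nth G (n - k)) (j - i)) (m - a)"
  have "mcoeff (fps_nth (fps_nth (F * G) n) j) m = (\<Sum>k=0..n. \<Sum>i=0..j. \<Sum>a | a \<subseteq># m. ?c k i a)"
    by (simp add: fps_mult_nth fps_sum_nth mcoeff_mult)
  also have "\<dots> = (\<Sum>k=0..n. \<Sum>a | a \<subseteq># m. \<Sum>i=0..j. ?c k i a)"
    by (rule sum.cong[OF refl sum.swap])
  also have "\<dots> = (\<Sum>a | a \<subseteq># m. \<Sum>k=0..n. \<Sum>i=0..j. ?c k i a)"
    by (rule sum.swap)
  also have "\<dots> = (\<Sum>a | a \<subseteq># m. \<Sum>i=0..j. \<Sum>k=0..n. ?c k i a)"
    by (rule sum.cong[OF refl sum.swap])
  finally show ?thesis .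
qed

lemma graded_ser_mult: "graded_ser (f * g) = graded_ser f * graded_ser g"
proof (rule mvps_fps_fps_eqI)
  fix n j m
  let ?F = "graded_ser f" and ?G = "graded_ser g"
  let ?c = "\<lambda>i a. if size m = n \<and> 0 \<notin># m
    then fps_nth (mcoeff f a) i * fps_nth (mcoeff g (m - a)) (j - i) else 0"
  have collapse: "(\<Sum>k=0..n. mcoeff (fps_nth (fps_nth ?F k) i) a *
      mcoeff (fps_nth (fps_nth ?G (n - k)) (j - i)) (m - a)) = ?c i a"
    if sub: "a \<subseteq># m" for i a
  proof -
    obtain b where m: "m = a + b" using sub by (metis subset_mset.add_diff_inverse)
    have "(\<Sum>k=0..n. mcoeff (fps_nth (fps_nth ?F k) i) a *
        mcoeff (fps_nth (fps_nth ?G (n - k)) (j - i)) (m - a)) =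
      (\<Sum>k=0..n. if k = size a then if size b = n - size a \<and> 0 \<notin># m
         then fps_nth (mcoeff f a) i * fps_nth (mcoeff g b) (j - i) else 0 else 0)"
      by (rule sum.cong) (auto simp: mcoeff_graded_ser m)
    thus ?thesis by (auto simp: m)
  qed
  have "mcoeff (fps_nth (fps_nth (?F * ?G) n) j) m = (\<Sum>a | a \<subseteq># m. \<Sum>i=0..j. ?c i a)"
    unfolding mcoeff_fps_fps_mult by (intro sum.cong refl collapse) simp
  also have "\<dots> = mcoeff (fps_nth (fps_nth (graded_ser (f * g)) n) j) m"
    by (auto simp: mcoeff_graded_ser mcoeff_mult fps_sum_nth fps_mult_nth)
  finally show "mcoeff (fps_nth (fps_nth (graded_ser (f * g)) n) j) m =
    mcoeff (fps_nth (fps_nth (?F * ?G) n) j) m" ..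
qed

lemma tvar_eq: "tvar = graded_ser (mmonom fps_X {#})"
  by (rule mvps_fps_fps_eqI)
    (auto simp: tvar_def mcoeff_graded_ser mcoeff_mmonom mcoeff_one fps_X_def)

lemma all_ge_one_iff_zero_notin: "(\<forall>i\<in>A. 1 \<le> i) \<longleftrightarrow> (0::nat) \<notin> A"
  by (metis less_one linorder_not_less)

lemma sorted_mset_eq_iff:
  "sorted w \<and> mset w = m \<longleftrightarrow> w = sorted_list_of_multiset m"
  by (metis mset_sorted_list_of_multiset sorted_list_of_multiset_mset sorted_sort_id
      sorted_sorted_list_of_multiset)

lemma mcoeff_hsym: "mcoeff (hsym n) m = (if size m = n \<and> 0 \<notin># m then 1 else 0)"
proof -
  have "{w \<in> {w. length w = n \<and> (\<forall>i\<in>set w. 1 \<le> i) \<and> sorted w}. mset w = m} =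
      {w. (sorted w \<and> mset w = m) \<and> size m = n \<and> 0 \<notin># m}"
    unfolding all_ge_one_iff_zero_notin by (auto simp flip: size_mset)
  also have "\<dots> = (if size m = n \<and> 0 \<notin># m then {sorted_list_of_multiset m} else {})"
    unfolding sorted_mset_eq_iff by auto
  finally show ?thesis by (simp add: hsym_def word_series_def)
qed

lemma Hgen_eq: "Hgen = graded_ser (hser 1)"
  by (rule mvps_fps_fps_eqI) (simp add: Hgen_def mcoeff_graded_ser mcoeff_hsym hser_def)

lemma Hgen_compose_eq: "fps_compose Hgen (zvar * tvar) = graded_ser (hser fps_X)"
proof -
  have "fps_compose Hgen (zvar * tvar) = Abs_fps (\<lambda>n. fps_X ^ n * fps_nth Hgen n)"
    unfolding zvar_def tvar_def mult.commute[of fps_X] by (rule fps_compose_linear)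
  thus ?thesis
    by (intro mvps_fps_fps_eqI)
      (simp add: Hgen_def mcoeff_graded_ser mcoeff_hsym hser_def fps_X_power_mult_nth
        fps_X_power_nth)
qed

definition desc_word :: "'v::linorder multiset \<Rightarrow> nat \<Rightarrow> 'v" where
  "desc_word m i = rev (sorted_list_of_multiset m) ! (i - 1)"

lemma length_sorted_list_of_multiset: "length (sorted_list_of_multiset m) = size m"
  by (metis mset_sorted_list_of_multiset size_mset)

lemma antimono_on_desc_word: "antimono_on {1..size m} (desc_word m)"
proof (rule monotone_onI)
  fix i j assume "i \<in> {1..size m}" "j \<in> {1..size m}" "i \<le> j"
  thus "desc_word m j \<le> desc_word m i"
    unfolding desc_word_def
    by (intro sorted_rev_nth_mono) (auto simp: length_sorted_list_of_multiset)
qed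

lemma image_mset_desc_word: "image_mset (desc_word m) (mset_set {1..size m}) = m"
proof -
  let ?w = "rev (sorted_list_of_multiset m)"
  have "image_mset (desc_word m) (mset_set {1..size m}) =
      image_mset (desc_word m) (image_mset Suc (mset_set {0..<size m}))"
    by (simp add: image_mset_mset_set atLeastLessThanSuc_atLeastAtMost)
  also have "\<dots> = mset (map ((!) ?w) [0..<length ?w])"
    by (simp add: multiset.map_comp comp_def desc_word_def length_sorted_list_of_multiset)
  also have "\<dots> = m" by (simp only: map_nth mset_rev mset_sorted_list_of_multiset)
  finally show ?thesis .
qed

lemma sorted_rev_iff_nth_pred:
  "sorted (rev w) \<longleftrightarrow> (\<forall>j\<in>{1..<length w}. w ! j \<le> w ! (j - 1))"
proof -
  have "{1..<length w} = Suc ` {..<length w - 1}"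
    by (cases "length w") (auto simp: image_Suc_lessThan)
  thus ?thesis by (auto simp: sorted_rev_iff_nth_Suc)
qed

lemma mcoeff_Fquasi:
  "mcoeff (Fquasi S n) m =
    (if size m = n \<and> 0 \<notin># m \<and> (\<forall>j\<in>S. desc_word m (j + 1) < desc_word m j) then 1 else 0)"
proof -
  have "{w \<in> {w. length w = n \<and> (\<forall>i\<in>set w. 1 \<le> i) \<and> (\<forall>j\<in>{1..<n}. w ! (j - 1) \<ge> w ! j) \<and>
      (\<forall>j\<in>S. w ! (j - 1) > w ! j)}. mset w = m} =
    {w. (sorted (rev w) \<and> mset (rev w) = m) \<and> size m = n \<and> 0 \<notin># m \<and>
      (\<forall>j\<in>S. w ! j < w ! (j - 1))}"
    unfolding all_ge_one_iff_zero_notin sorted_rev_iff_nth_pred by (auto simp flip: size_mset)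
  also have "\<dots> = (if size m = n \<and> 0 \<notin># m \<and> (\<forall>j\<in>S. desc_word m (j + 1) < desc_word m j)
      then {rev (sorted_list_of_multiset m)} else {})"
    unfolding sorted_mset_eq_iff rev_swap by (auto simp: desc_word_def)
  finally show ?thesis by (simp add: Fquasi_def word_series_def)
qed

lemma mcoeff_Qeuler:
  "mcoeff (Qeuler n j) m =
    (if size m = n \<and> 0 \<notin># m
     then fps_nth (mcoeff (eser fps_X * diag_ser (block_form fps_X)) m) j else 0)"
proof (cases "size m = n \<and> 0 \<notin># m")
  case True
  have "mcoeff (Qeuler n j) m =
      (\<Sum>\<sigma> | \<sigma> permutes {1..n} \<and> exc n \<sigma> = j. if exd_compatible n (desc_word m) \<sigma> then 1 else 0)"
    using True by (simp add: Qeuler_def mcoeff_Fquasi exd_compatible_def)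
  also have "\<dots> = (\<Sum>\<sigma>\<in>exd_compatible_perms n (desc_word m). if exc n \<sigma> = j then 1 else 0)"
    by (simp add: exd_compatible_perms_def sum.If_cases finite_permutations Int_def conj_ac)
  also have "\<dots> = fps_nth (\<Sum>\<sigma>\<in>exd_compatible_perms n (desc_word m). fps_X ^ exc n \<sigma>) j"
    by (simp add: fps_sum_nth fps_X_power_nth eq_commute[of j])
  also have "\<dots> = fps_nth (mcoeff (eser fps_X * diag_ser (block_form fps_X)) m) j"
    using True image_mset_desc_word[of m]
      sum_power_exc_eq_mcoeff[OF antimono_on_desc_word[of m], of "fps_X :: int fps"] by simp
  finally show ?thesis using True by simp
next
  case False
  thus ?thesis by (auto simp: Qeuler_def mcoeff_Fquasi)
qed

lemma Qgen_eq: "Qgen = graded_ser (eser fps_X * diag_ser (block_form fps_X))"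
  by (rule mvps_fps_fps_eqI) (simp add: Qgen_def mcoeff_graded_ser mcoeff_Qeuler)

lemma fps_dvd_one_iff:
  fixes f :: "'a::comm_ring_1 fps"
  shows "f dvd 1 \<longleftrightarrow> fps_nth f 0 dvd 1"
  by (metis dvdE dvdI fps_mult_nth_0 fps_one_nth fps_right_inverse)

theorem theorem2p1:
  shows "(fps_compose Hgen (zvar * tvar) - tvar * Hgen) dvd 1
    \<and> Qgen = unit_quot ((1 - tvar) * Hgen) (fps_compose Hgen (zvar * tvar) - tvar * Hgen)"
proof
  have "hsym 0 = 1"
    by (rule mvps_eqI) (simp add: mcoeff_hsym mcoeff_one)
  thus unit: "(fps_compose Hgen (zvar * tvar) - tvar * Hgen) dvd 1"
    by (simp add: fps_dvd_one_iff Hgen_def tvar_def)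
  let ?t = "mmonom fps_X {#} :: (nat, int fps) mvps"
  have "Qgen * (fps_compose Hgen (zvar * tvar) - tvar * Hgen) =
      graded_ser (eser fps_X * diag_ser (block_form fps_X) * (hser fps_X - ?t * hser 1))"
    unfolding Hgen_compose_eq by (simp add: Qgen_eq Hgen_eq tvar_eq graded_ser_diff graded_ser_mult)
  also have "\<dots> = graded_ser ((1 - ?t) * hser 1)"
    by (simp only: eser_mult_diag_ser_block_form_mult_hser_diff)
  also have "\<dots> = (1 - tvar) * Hgen"
    by (simp add: Hgen_eq tvar_eq graded_ser_diff graded_ser_mult graded_ser_one)
  finally show "Qgen = unit_quot ((1 - tvar) * Hgen) (fps_compose Hgen (zvar * tvar) - tvar * Hgen)"
    by (simp only: unit_quot_eq_iff[OF unit])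
qed

end
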